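(* Let $n\ge 2$ be an integer and let $B$ be an $n\times n$ symmetric stochastic matrix with $B_{ii}=0$ for all $i=1,\ldots,n$. Then $$\det (I_n+B)\le 2\left(1-\frac{1}{n-1}\right)^{n-1}.$$ Moreover, the inequality is sharp: for every $n\ge 2$ there exists an $n\times n$ symmetric stochastic matrix $B$ with $B_{ii}=0$ for all $i$ for which equality holds.
   Context: A (row) stochastic matrix is a square matrix of nonnegative real numbers, with each row summing to $1$. $I_n$ denotes the $n\times n$ identity matrix. *)

theory Defs
  imports Complex_Main "Jordan_Normal_Form.Determinant"
begin

definition symmetric_mat :: "'a mat \<Rightarrow> bool" where
  "symmetric_mat A \<longleftrightarrow> transpose_mat A = A"

definition stochastic_mat :: "real mat \<Rightarrow> bool" where
  "stochastic_mat A \<longleftrightarrow>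
     square_mat A \<and>
     (\<forall>i < dim_row A. \<forall>j < dim_col A. A $$ (i, j) \<ge> 0) \<and>
     (\<forall>i < dim_row A. (\<Sum>j < dim_col A. A $$ (i, j)) = 1)"

definition zero_diagonal :: "'a :: zero mat \<Rightarrow> bool" where
  "zero_diagonal A \<longleftrightarrow> (\<forall>i < dim_row A. A $$ (i, i) = 0)"

end

theory Submission
  imports Defs "Jordan_Normal_Form.Schur_Decomposition"
begin

text \<open>
  The eigenvalues of \<open>I + B\<close> are real, nonnegative and sum up to \<open>n\<close>, and one of them is
  \<open>2\<close>, with the all-ones eigenvector. By AM-GM the product of the other \<open>n - 1\<close>, whose sum is
  \<open>n - 2\<close>, is at most \<open>((n - 2) / (n - 1)) ^ (n - 1)\<close>. For equality, these have to coincide, which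
  happens if all off-diagonal entries of \<open>B\<close> are \<open>1 / (n - 1)\<close>.
\<close>

section \<open>AM-GM for lists of nonnegative reals\<close>

text \<open>Multiply the bounds \<open>x \<le> a * exp (x / a - 1)\<close> over all entries; each is
  \<open>1 + t \<le> exp t\<close> at \<open>t = x / a - 1\<close>. This is Polya's route to AM-GM:
  the exponential factor becomes 1 when \<open>a\<close> is the mean.\<close>

lemma prod_list_le_exp_sum_list:
  fixes xs :: "real list"
  assumes "a > 0" and "\<And>x. x \<in> set xs \<Longrightarrow> 0 \<le> x"
  shows "prod_list xs \<le> a ^ length xs * exp (sum_list xs / a - real (length xs))"
  using assms(2)
proof (induction xs)
  case (Cons x xs)
  have "x / a \<le> exp (x / a - 1)"
    using exp_ge_add_one_self[of "x / a - 1"] by simp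
  then have "x \<le> a * exp (x / a - 1)"
    using \<open>a > 0\<close> by (simp add: field_simps)
  moreover have "0 \<le> prod_list xs"
    using Cons.prems by (intro prod_list_nonneg) auto
  ultimately have "x * prod_list xs \<le> (a * exp (x / a - 1)) *
      (a ^ length xs * exp (sum_list xs / a - real (length xs)))"
    using Cons \<open>a > 0\<close> by (intro mult_mono) auto
  also have "\<dots> = a ^ length (x # xs) * (exp (x / a - 1) * exp (sum_list xs / a - real (length xs)))"
    by simp
  also have "\<dots> = a ^ length (x # xs) * exp (sum_list (x # xs) / a - real (length (x # xs)))"
    by (simp add: exp_add[symmetric] add_divide_distrib algebra_simps)
  finally show ?case by simp
qed simp

lemma prod_list_le_mean_power:
  fixes xs :: "real list"
  assumes nonneg: "\<And>x. x \<in> set xs \<Longrightarrow> 0 \<le> x"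
  shows "prod_list xs \<le> (sum_list xs / real (length xs)) ^ length xs"
proof (cases "sum_list xs = 0 \<or> xs = []")
  \<comment> \<open>The mean is to serve as \<open>a\<close>, which must be positive, so a zero sum
    is treated apart: it forces all entries to vanish. The empty list belongs here too, with both
    sides equal to 1.\<close>
  case True
  then have "\<forall>x \<in> set xs. x = 0"
    using nonneg by (auto simp: sum_list_nonneg_eq_0_iff)
  then have "xs = replicate (length xs) 0"
    by (simp add: replicate_length_same)
  then show ?thesis
    by (metis div_0 length_replicate mult_zero_right order_refl prod_list_replicate sum_list_replicate)
next
  case False
  then have "sum_list xs > 0"
    using nonneg by (simp add: sum_list_nonneg order_less_le)
  then show ?thesis
    using prod_list_le_exp_sum_list[of "sum_list xs / real (length xs)" xs] nonneg False by simp
qed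

text \<open>The deviations \<open>x - a\<close> are nonnegative and sum to 0. This later pins down
  the spectrum of the extremal matrix without computing multiplicities.\<close>

lemma all_eq_if_sum_list_le:
  fixes xs :: "real list"
  assumes "\<And>x. x \<in> set xs \<Longrightarrow> a \<le> x" and "sum_list xs = real (length xs) * a"
  shows "xs = replicate (length xs) a"
proof -
  have "sum_list (map (\<lambda>x. x - a) xs) = 0"
    using assms(2) by (simp add: sum_list_subtractf sum_list_triv)
  then have "\<forall>x \<in> set xs. x - a = 0"
    using assms(1) by (subst (asm) sum_list_nonneg_eq_0_iff) auto
  then show ?thesis
    by (intro replicate_length_same[symmetric]) auto
qed

section \<open>Determinant and trace from the spectrum\<close>

lemma sum_diag_mult_commute:
  fixes A B :: "'a :: comm_semiring_1 mat"
  assumes "A \<in> carrier_mat n n" and "B \<in> carrier_mat n n"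
  shows "(\<Sum>i<n. (A * B) $$ (i, i)) = (\<Sum>i<n. (B * A) $$ (i, i))"
proof -
  have "(\<Sum>i<n. (A * B) $$ (i, i)) = (\<Sum>i<n. \<Sum>j<n. A $$ (i, j) * B $$ (j, i))"
    using assms by (intro sum.cong) (auto simp: scalar_prod_def atLeast0LessThan)
  also have "\<dots> = (\<Sum>j<n. \<Sum>i<n. B $$ (j, i) * A $$ (i, j))"
    by (subst sum.swap) (simp add: mult.commute)
  also have "\<dots> = (\<Sum>j<n. (B * A) $$ (j, j))"
    using assms by (intro sum.cong) (auto simp: scalar_prod_def atLeast0LessThan)
  finally show ?thesis .
qed

text \<open>By Schur decomposition \<open>A\<close> is similar to an upper triangular matrix with
  diagonal \<open>es\<close>, and similarity preserves both determinant and trace.\<close>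

lemma
  fixes A :: "'a :: conjugatable_ordered_field mat"
  assumes A: "A \<in> carrier_mat n n" and es: "char_poly A = (\<Prod>e \<leftarrow> es. [:- e, 1:])"
  shows det_eq_prod_list_roots: "det A = prod_list es"
    and trace_eq_sum_list_roots: "(\<Sum>i<n. A $$ (i, i)) = sum_list es"
proof -
  obtain T P Q where "schur_decomposition A es = (T, P, Q)"
    by (metis prod_cases3)
  from schur_decomposition[OF A es this]
  have sim: "similar_mat_wit A T P Q" and T: "upper_triangular T" "diag_mat T = es"
    by auto
  note wit = similar_mat_witD2[OF A sim]
  have "det A = det T"
    using sim by (intro det_similar) (auto simp: similar_mat_def)
  also have "\<dots> = prod_list es"
    using det_upper_triangular[OF T(1) wit(5)] T(2) by simp
  finally show "det A = prod_list es" .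
  \<comment> \<open>Write \<open>A = (P * T) * Q\<close> and move \<open>Q\<close> to the front,
    where it cancels \<open>P\<close>.\<close>
  have "(\<Sum>i<n. A $$ (i, i)) = (\<Sum>i<n. (Q * (P * T)) $$ (i, i))"
    unfolding wit(3) using wit by (intro sum_diag_mult_commute) auto
  also have "Q * (P * T) = T"
    using wit by (simp add: assoc_mult_mat[symmetric, of Q n n P n T n])
  also have "(\<Sum>i<n. T $$ (i, i)) = sum_list (diag_mat T)"
    using wit(5) by (auto simp: diag_mat_def sum_list_distinct_conv_sum_set atLeast0LessThan)
  finally show "(\<Sum>i<n. A $$ (i, i)) = sum_list es"
    using T(2) by simp
qed

section \<open>Real spectrum of symmetric real matrices\<close>

lemma symmetric_mat_index:
  assumes "symmetric_mat A" and "A \<in> carrier_mat n n" and "i < n" and "j < n"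
  shows "A $$ (i, j) = A $$ (j, i)"
  using assms unfolding symmetric_mat_def by (metis carrier_matD index_transpose_mat(1))

lemma eigenvector_index:
  assumes "eigenvector A v k" and "A \<in> carrier_mat n n" and "i < n"
  shows "(\<Sum>j<n. A $$ (i, j) * v $ j) = k * v $ i"
proof -
  have v: "v \<in> carrier_vec n" and "A *\<^sub>v v = k \<cdot>\<^sub>v v"
    using assms unfolding eigenvector_def by auto
  then have "(A *\<^sub>v v) $ i = k * v $ i"
    using assms(3) by simp
  then show ?thesis
    using v assms(2,3) by (simp add: scalar_prod_def atLeast0LessThan)
qed

lemma eigenvector_nonzero_index:
  assumes "eigenvector A v k" and "A \<in> carrier_mat n n"
  obtains i where "i < n" and "v $ i \<noteq> 0"
proof -
  have "v \<in> carrier_vec n" and "v \<noteq> 0\<^sub>v n"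
    using assms unfolding eigenvector_def by auto
  then show ?thesis
    using that by (metis carrier_vecD eq_vecI index_zero_vec)
qed

text \<open>For an eigenvector \<open>v\<close>, the Hermitian form \<open>q\<close> of
  \<open>A\<close> at \<open>v\<close> is \<open>k\<close> times the squared norm
  \<open>N > 0\<close>, and it is its own conjugate, so \<open>k\<close> is real.\<close>

lemma symmetric_mat_eigenvalue_real:
  fixes A :: "real mat"
  assumes A: "A \<in> carrier_mat n n" and sym: "symmetric_mat A"
    and k: "eigenvalue (map_mat complex_of_real A) k"
  shows "k \<in> \<real>"
proof -
  let ?C = "map_mat complex_of_real A"
  have C: "?C \<in> carrier_mat n n"
    using A by simp
  obtain v where v: "eigenvector ?C v k"
    using k unfolding eigenvalue_def by blast
  define N where "N = (\<Sum>i<n. (cmod (v $ i))\<^sup>2)"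
  define q where "q = (\<Sum>i<n. \<Sum>j<n. cnj (v $ i) * ?C $$ (i, j) * v $ j)"
  obtain i where "i < n" and "v $ i \<noteq> 0"
    using eigenvector_nonzero_index[OF v C] .
  then have "N > 0"
    unfolding N_def by (intro sum_pos2[where i = i]) auto
  have "q = (\<Sum>i<n. cnj (v $ i) * (k * v $ i))"
    unfolding q_def using eigenvector_index[OF v C]
    by (intro sum.cong) (auto simp: mult.assoc simp flip: sum_distrib_left)
  also have "\<dots> = (\<Sum>i<n. k * of_real ((cmod (v $ i))\<^sup>2))"
    by (simp add: complex_norm_square ac_simps del: of_real_power)
  also have "\<dots> = k * of_real N"
    by (simp add: N_def sum_distrib_left)
  finally have q: "q = k * of_real N" .
  \<comment> \<open>The entries of \<open>A\<close> are real, so conjugation only moves the bar from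
    \<open>v $ i\<close> to \<open>v $ j\<close>; renaming the indices and using symmetry restores
    \<open>q\<close>.\<close>
  have "cnj q = (\<Sum>i<n. \<Sum>j<n. v $ i * ?C $$ (i, j) * cnj (v $ j))"
    unfolding q_def using A by (auto simp: cnj_sum intro!: sum.cong)
  also have "\<dots> = (\<Sum>j<n. \<Sum>i<n. v $ i * ?C $$ (i, j) * cnj (v $ j))"
    by (rule sum.swap)
  also have "\<dots> = q"
    unfolding q_def using A symmetric_mat_index[OF sym A] by (auto intro!: sum.cong)
  finally have "cnj k = k"
    using q \<open>N > 0\<close> by simp
  then show ?thesis
    by (simp add: Reals_cnj_iff)
qed

text \<open>The characteristic polynomial splits over the complex numbers. Its roots are
  eigenvalues, hence real, so the factorization descends to the reals.\<close>

lemma symmetric_mat_char_poly_factorized: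
  fixes A :: "real mat"
  assumes A: "A \<in> carrier_mat n n" and sym: "symmetric_mat A"
  obtains es where "char_poly A = (\<Prod>e \<leftarrow> es. [:- e, 1:])" and "length es = n"
proof -
  let ?C = "map_mat complex_of_real A"
  have C: "?C \<in> carrier_mat n n"
    using A by simp
  obtain zs where zs: "char_poly ?C = (\<Prod>z \<leftarrow> zs. [:- z, 1:])" and len: "length zs = n"
    using char_poly_factorized[OF C] by blast
  interpret map_poly_inj_comm_ring_hom complex_of_real ..
  have "z \<in> \<real>" if "z \<in> set zs" for z
  proof (rule symmetric_mat_eigenvalue_real[OF A sym])
    show "eigenvalue ?C z"
      unfolding eigenvalue_root_char_poly[OF C] zs using that
      by (auto simp: poly_prod_list prod_list_zero_iff)
  qed
  then have "map (map_poly complex_of_real) (map (\<lambda>e. [:- e, 1:]) (map Re zs)) =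
      map (\<lambda>z. [:- z, 1:]) zs"
    by simp
  then have "map_poly complex_of_real (\<Prod>e \<leftarrow> map Re zs. [:- e, 1:]) = (\<Prod>z \<leftarrow> zs. [:- z, 1:])"
    by (simp only: hom_prod_list)
  then have "map_poly complex_of_real (\<Prod>e \<leftarrow> map Re zs. [:- e, 1:]) =
      map_poly complex_of_real (char_poly A)"
    using zs of_real_hom.char_poly_hom[OF A] by metis
  \<comment> \<open>Embedding real polynomials into complex ones is injective.\<close>
  then have "char_poly A = (\<Prod>e \<leftarrow> map Re zs. [:- e, 1:])"
    by (simp only: eq_iff)
  then show ?thesis
    using that[of "map Re zs"] len by simp
qed

section \<open>Spectrum of \<open>I + B\<close> and the upper bound\<close>

context
  fixes B :: "real mat" and n :: nat
  assumes B: "B \<in> carrier_mat n n" and sym: "symmetric_mat B" and stoch: "stochastic_mat B"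
begin

lemma row_sum: "i < n \<Longrightarrow> (\<Sum>j<n. B $$ (i, j)) = 1"
  using B stoch unfolding stochastic_mat_def by auto

lemma eigenvector_one_plus_index:
  assumes "eigenvector (1\<^sub>m n + B) v k" and "i < n"
  shows "v $ i + (\<Sum>j<n. B $$ (i, j) * v $ j) = k * v $ i"
proof -
  have "k * v $ i = (\<Sum>j<n. (1\<^sub>m n + B) $$ (i, j) * v $ j)"
    using eigenvector_index[OF assms(1) _ assms(2)] B by simp
  also have "\<dots> = (\<Sum>j<n. (if i = j then v $ j else 0) + B $$ (i, j) * v $ j)"
    using B assms(2) by (intro sum.cong) (auto simp: distrib_right)
  also have "\<dots> = v $ i + (\<Sum>j<n. B $$ (i, j) * v $ j)"
    using assms(2) by (simp add: sum.distrib)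
  finally show ?thesis by simp
qed

text \<open>The form \<open>v\<^sup>T (I + B) v\<close> is a sum of squares: it equals
  \<open>(\<Sum>i j. B\<^sub>i\<^sub>j (v\<^sub>i + v\<^sub>j)\<^sup>2) / 2\<close>.\<close>

lemma eigenvalue_one_plus_nonneg:
  assumes "eigenvalue (1\<^sub>m n + B) k"
  shows "0 \<le> k"
proof -
  obtain v where v: "eigenvector (1\<^sub>m n + B) v k"
    using assms unfolding eigenvalue_def by blast
  define N where "N = (\<Sum>i<n. (v $ i)\<^sup>2)"
  define q where "q = (\<Sum>i<n. \<Sum>j<n. B $$ (i, j) * v $ i * v $ j)"
  have "k * N = (\<Sum>i<n. v $ i * (v $ i + (\<Sum>j<n. B $$ (i, j) * v $ j)))"
    unfolding N_def sum_distrib_left using eigenvector_one_plus_index[OF v]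
    by (intro sum.cong) (auto simp: power2_eq_square)
  also have "\<dots> = N + q"
    by (simp add: N_def q_def distrib_left sum.distrib power2_eq_square sum_distrib_left ac_simps)
  finally have kN: "k * N = N + q" .
  \<comment> \<open>Rows sum to 1, and by symmetry so do columns; hence both square terms in the
    expansion of the form contribute \<open>N\<close>, and the cross term contributes
    \<open>2 * q\<close>.\<close>
  have rows: "(\<Sum>i<n. \<Sum>j<n. B $$ (i, j) * (v $ i)\<^sup>2) = N"
    using row_sum by (simp add: N_def flip: sum_distrib_right)
  have "(\<Sum>i<n. \<Sum>j<n. B $$ (i, j) * (v $ j)\<^sup>2) = (\<Sum>j<n. \<Sum>i<n. B $$ (i, j) * (v $ j)\<^sup>2)"
    by (rule sum.swap)
  also have "\<dots> = N"
    using rows symmetric_mat_index[OF sym B] by simp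
  finally have cols: "(\<Sum>i<n. \<Sum>j<n. B $$ (i, j) * (v $ j)\<^sup>2) = N" .
  have "0 \<le> (\<Sum>i<n. \<Sum>j<n. B $$ (i, j) * (v $ i + v $ j)\<^sup>2)"
    using B stoch unfolding stochastic_mat_def by (intro sum_nonneg mult_nonneg_nonneg) auto
  also have "\<dots> = (\<Sum>i<n. \<Sum>j<n. B $$ (i, j) * (v $ i)\<^sup>2 + B $$ (i, j) * (v $ j)\<^sup>2 +
      2 * (B $$ (i, j) * v $ i * v $ j))"
    by (intro sum.cong) (auto simp: power2_eq_square algebra_simps)
  also have "\<dots> = 2 * (N + q)"
    by (simp add: sum.distrib rows cols q_def flip: sum_distrib_left)
  finally have "0 \<le> k * N"
    using kN by simp
  moreover obtain i where "i < n" and "v $ i \<noteq> 0"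
    using eigenvector_nonzero_index[OF v, of n] B by auto
  then have "N > 0"
    unfolding N_def by (intro sum_pos2[where i = i]) auto
  ultimately show ?thesis
    by (simp add: zero_le_mult_iff)
qed

lemma eigenvalue_one_plus_two:
  assumes "n > 0"
  shows "eigenvalue (1\<^sub>m n + B) 2"
proof -
  let ?u = "vec n (\<lambda>_. 1 :: real)"
  have "(\<Sum>j<n. (1\<^sub>m n + B) $$ (i, j)) = 2" if "i < n" for i
  proof -
    have "(\<Sum>j<n. (1\<^sub>m n + B) $$ (i, j)) = (\<Sum>j<n. (if i = j then 1 else 0) + B $$ (i, j))"
      using B that by (intro sum.cong) auto
    then show ?thesis
      using that row_sum by (simp add: sum.distrib)
  qed
  then have "(1\<^sub>m n + B) *\<^sub>v ?u = 2 \<cdot>\<^sub>v ?u"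
    using B by (intro eq_vecI) (auto simp: scalar_prod_def atLeast0LessThan)
  moreover have "?u \<noteq> 0\<^sub>v n"
    using assms by (metis index_vec index_zero_vec(1) zero_neq_one)
  ultimately show ?thesis
    using B unfolding eigenvalue_def eigenvector_def by (intro exI[of _ ?u]) auto
qed

text \<open>The list \<open>es\<close> is the spectrum with one copy of 2 removed. Both the bound
  and the equality case rest on its sum, which comes from the trace: every diagonal entry of
  \<open>I + B\<close> is 1.\<close>

lemma other_eigenvalues:
  assumes "zero_diagonal B" and "n > 0"
  obtains es where "det (1\<^sub>m n + B) = 2 * prod_list es" and "sum_list es = real n - 2"
    and "length es = n - 1" and "\<And>e. e \<in> set es \<Longrightarrow> eigenvalue (1\<^sub>m n + B) e"
proof -
  let ?M = "1\<^sub>m n + B"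
  have M: "?M \<in> carrier_mat n n" and "symmetric_mat ?M"
    using B sym unfolding symmetric_mat_def by (auto simp: transpose_add[of _ n n])
  then obtain es where es: "char_poly ?M = (\<Prod>e \<leftarrow> es. [:- e, 1:])" and len: "length es = n"
    using symmetric_mat_char_poly_factorized by blast
  have ev: "eigenvalue ?M e \<longleftrightarrow> e \<in> set es" for e
    unfolding eigenvalue_root_char_poly[OF M] es
    by (auto simp: poly_prod_list prod_list_zero_iff)
  have two: "2 \<in> set es"
    using eigenvalue_one_plus_two[OF assms(2)] ev by simp
  have "sum_list es = (\<Sum>i<n. ?M $$ (i, i))"
    using trace_eq_sum_list_roots[OF M es] by simp
  also have "\<dots> = real n"
    using assms(1) B by (simp add: zero_diagonal_def)
  \<comment> \<open>Only one occurrence of 2 is deleted: the eigenvalue may be multiple, and the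
    further copies must stay.\<close>
  finally have "sum_list (remove1 2 es) = real n - 2"
    using sum_list_map_remove1[OF two, of id] by simp
  moreover have "det ?M = 2 * prod_list (remove1 2 es)"
    using det_eq_prod_list_roots[OF M es] prod_list_map_remove1[OF two, of id] by simp
  moreover have "length (remove1 2 es) = n - 1"
    using two len by (simp add: length_remove1)
  moreover have "eigenvalue ?M e" if "e \<in> set (remove1 2 es)" for e
    using that ev set_remove1_subset by fastforce
  ultimately show ?thesis
    using that by blast
qed

lemma det_one_plus_le:
  assumes "zero_diagonal B" and "n \<ge> 2"
  shows "det (1\<^sub>m n + B) \<le> 2 * (1 - 1 / (real n - 1)) ^ (n - 1)"
proof -
  obtain es where es: "det (1\<^sub>m n + B) = 2 * prod_list es" "sum_list es = real n - 2"
      "length es = n - 1" "\<And>e. e \<in> set es \<Longrightarrow> eigenvalue (1\<^sub>m n + B) e"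
    using other_eigenvalues[OF assms(1)] assms(2) by auto
  have "prod_list es \<le> (sum_list es / real (length es)) ^ length es"
    using es(4) eigenvalue_one_plus_nonneg by (intro prod_list_le_mean_power) blast
  also have "sum_list es / real (length es) = 1 - 1 / (real n - 1)"
    using es(2,3) assms(2) by (simp add: field_simps)
  finally show ?thesis
    using es(1,3) by simp
qed

end

section \<open>The extremal matrix\<close>

text \<open>For \<open>n \<ge> 2\<close> this is the transition matrix of the simple random walk on
  the complete graph.\<close>

definition uniform_offdiag_mat :: "nat \<Rightarrow> real mat" where
  "uniform_offdiag_mat n = mat n n (\<lambda>(i, j). if i = j then 0 else 1 / (real n - 1))"

lemma uniform_offdiag_mat_carrier: "uniform_offdiag_mat n \<in> carrier_mat n n"
  by (simp add: uniform_offdiag_mat_def)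

text \<open>The matrix is \<open>(J - I) / (n - 1)\<close> with \<open>J\<close> the all-ones
  matrix. Taking \<open>f\<close> constant gives the row sums, taking \<open>f\<close> an
  eigenvector gives the eigenvalue equation.\<close>

lemma uniform_offdiag_mat_row_mult:
  assumes "i < n"
  shows "(\<Sum>j<n. uniform_offdiag_mat n $$ (i, j) * f j) = ((\<Sum>j<n. f j) - f i) / (real n - 1)"
proof -
  have "(\<Sum>j<n. uniform_offdiag_mat n $$ (i, j) * f j) =
      (\<Sum>j<n. f j / (real n - 1) - (if i = j then f j / (real n - 1) else 0))"
    using assms by (intro sum.cong) (auto simp: uniform_offdiag_mat_def)
  then show ?thesis
    using assms by (simp add: sum_subtractf sum_divide_distrib diff_divide_distrib)
qed

lemma symmetric_uniform_offdiag_mat: "symmetric_mat (uniform_offdiag_mat n)"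
  unfolding symmetric_mat_def uniform_offdiag_mat_def by (intro eq_matI) auto

lemma stochastic_uniform_offdiag_mat: "n \<ge> 2 \<Longrightarrow> stochastic_mat (uniform_offdiag_mat n)"
  using uniform_offdiag_mat_row_mult[of _ n "\<lambda>_. 1"]
  unfolding stochastic_mat_def by (auto simp: uniform_offdiag_mat_def)

lemma zero_diagonal_uniform_offdiag_mat: "zero_diagonal (uniform_offdiag_mat n)"
  unfolding zero_diagonal_def uniform_offdiag_mat_def by simp

lemma eigenvalue_one_plus_uniform_offdiag_mat:
  assumes n: "n \<ge> 2" and "eigenvalue (1\<^sub>m n + uniform_offdiag_mat n) k"
  shows "k = 2 \<or> k = 1 - 1 / (real n - 1)"
proof -
  obtain v where v: "eigenvector (1\<^sub>m n + uniform_offdiag_mat n) v k"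
    using assms(2) unfolding eigenvalue_def by blast
  define s where "s = (\<Sum>j<n. v $ j)"
  have eq: "v $ i + (s - v $ i) / (real n - 1) = k * v $ i" if "i < n" for i
    using eigenvector_one_plus_index[OF uniform_offdiag_mat_carrier
        symmetric_uniform_offdiag_mat stochastic_uniform_offdiag_mat[OF n] v that]
      uniform_offdiag_mat_row_mult[OF that] by (simp add: s_def)
  \<comment> \<open>Adding up the eigenvalue equations over all \<open>i\<close> yields
    \<open>k * s = 2 * s\<close>. So either \<open>k = 2\<close>, or the entries of \<open>v\<close>
    sum to 0 and each single equation determines \<open>k\<close>.\<close>
  have "k * s = (\<Sum>i<n. v $ i + (s - v $ i) / (real n - 1))"
    using eq by (simp add: s_def sum_distrib_left)
  also have "\<dots> = s + (real n * s - s) / (real n - 1)"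
    by (simp add: sum.distrib sum_subtractf s_def flip: sum_divide_distrib)
  also have "\<dots> = 2 * s"
    using n by (simp add: field_simps)
  finally consider "k = 2" | "s = 0" by auto
  then show ?thesis
  proof cases
    case 2
    obtain i where "i < n" and "v $ i \<noteq> 0"
      using eigenvector_nonzero_index[OF v, of n] uniform_offdiag_mat_carrier by auto
    then have "(1 - 1 / (real n - 1)) * v $ i = k * v $ i"
      using eq[of i] 2 by (simp add: algebra_simps)
    then show ?thesis
      using \<open>v $ i \<noteq> 0\<close> by simp
  qed simp
qed

text \<open>The remaining \<open>n - 1\<close> eigenvalues lie in \<open>{2, ?a}\<close>, so each is
  at least \<open>?a\<close>, while the trace makes their mean exactly \<open>?a\<close>. Hence all
  of them equal \<open>?a\<close>.\<close>

lemma det_one_plus_uniform_offdiag_mat: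
  assumes "n \<ge> 2"
  shows "det (1\<^sub>m n + uniform_offdiag_mat n) = 2 * (1 - 1 / (real n - 1)) ^ (n - 1)"
proof -
  let ?a = "1 - 1 / (real n - 1)"
  obtain es where es: "det (1\<^sub>m n + uniform_offdiag_mat n) = 2 * prod_list es"
      "sum_list es = real n - 2" "length es = n - 1"
      "\<And>e. e \<in> set es \<Longrightarrow> eigenvalue (1\<^sub>m n + uniform_offdiag_mat n) e"
    using other_eigenvalues[OF uniform_offdiag_mat_carrier symmetric_uniform_offdiag_mat
        stochastic_uniform_offdiag_mat[OF assms] zero_diagonal_uniform_offdiag_mat] assms
    by auto
  have "?a \<le> 1"
    using assms by simp
  then have "?a \<le> e" if "e \<in> set es" for e
    using eigenvalue_one_plus_uniform_offdiag_mat[OF assms es(4)[OF that]] by linarith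
  moreover have "sum_list es = real (length es) * ?a"
    using es(2,3) assms by (simp add: right_diff_distrib)
  ultimately have "es = replicate (n - 1) ?a"
    using all_eq_if_sum_list_le[of es ?a] es(3) by simp
  then show ?thesis
    using es(1) by simp
qed

theorem theorem2:
  fixes n :: nat
  assumes "n \<ge> 2"
  shows "(\<forall>B \<in> carrier_mat n n.
            symmetric_mat B \<and> stochastic_mat B \<and> zero_diagonal B \<longrightarrow>
            det (1\<^sub>m n + B) \<le> 2 * (1 - 1 / (real n - 1)) ^ (n - 1)) \<and>
         (\<exists>B \<in> carrier_mat n n.
            symmetric_mat B \<and> stochastic_mat B \<and> zero_diagonal B \<and>
            det (1\<^sub>m n + B) = 2 * (1 - 1 / (real n - 1)) ^ (n - 1))"
  using assms det_one_plus_le uniform_offdiag_mat_carrier symmetric_uniform_offdiag_mat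
    stochastic_uniform_offdiag_mat zero_diagonal_uniform_offdiag_mat
    det_one_plus_uniform_offdiag_mat
  by blast

end
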